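(* Let $n=p_1^{k_1}\cdots p_t^{k_t}$ where $t\ge2$, $p_1<\cdots<p_t$ are primes, and $k_1,\dots,k_t$ are nonnegative integers. Let $r$ be an integer with $0\le r\le n$ such that $p_i\nmid r$ for every $i$ and $\binom nr\ge\sum_{i=1}^t\sum_{j=1}^{k_i}p_i^j\binom n{p_i^j}$. Then $$\binom nr=\frac{\binom nr-\sum_{i=1}^t\sum_{j=1}^{k_i}p_i^j\binom n{p_i^j}}{n}\binom n1+\sum_{i=1}^t\sum_{j=1}^{k_i}p_i^j\binom n{p_i^j},$$ and this is a representation of $\binom nr$ as a nonnegative integer combination of $\binom n1$ and the $\binom n{p_i^j}$ ($1\le i\le t$, $1\le j\le k_i$); that is, the coefficient $\frac1n\left(\binom nr-\sum_{i=1}^t\sum_{j=1}^{k_i}p_i^j\binom n{p_i^j}\right)$ is a nonnegative integer.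
   Context: Empty sums equal $0$. *)

theory Defs
  imports Complex_Main "HOL-Computational_Algebra.Primes"
begin

end

theory Submission imports Defs begin

text \<open>Since \<open>n choose 1\<close> is \<open>n\<close>, the identity is mere cancellation,
  and the content is that \<open>n\<close> divides the numerator of the coefficient. It divides each
  summand \<open>m * (n choose m)\<close> by absorption, m * C(n,m) = n * C(n-1,m-1)
  (\<open>dvd_mult_binomial\<close>). The assumed inequality gives the sign.\<close>

lemma dvd_mult_binomial:
  fixes n m :: nat
  assumes "0 < m"
  shows "n dvd m * (n choose m)"
  using times_binomial_minus1_eq[OF assms, of n] by simp

lemma dvd_binomial_if_coprime:
  fixes n r :: nat
  assumes "coprime n r" and "0 < r"
  shows "n dvd (n choose r)"
  using dvd_mult_binomial[OF assms(2), of n] assms(1) coprime_dvd_mult_right_iff by blast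

theorem theorem4p3:
  fixes n t r :: nat and p k :: "nat \<Rightarrow> nat"
  assumes "t \<ge> 2"
    and "\<And>i. i \<in> {1..t} \<Longrightarrow> prime (p i)"
    and "strict_mono_on {1..t} p"
    and "n = (\<Prod>i=1..t. p i ^ k i)"
    and "r \<le> n"
    and "\<And>i. i \<in> {1..t} \<Longrightarrow> \<not> p i dvd r"
    and "(n choose r) \<ge> (\<Sum>i=1..t. \<Sum>j=1..k i. p i ^ j * (n choose (p i ^ j)))"
  shows "real (n choose r) =
      (real (n choose r) - (\<Sum>i=1..t. \<Sum>j=1..k i. real (p i ^ j) * real (n choose (p i ^ j)))) / real n
        * real (n choose 1)
      + (\<Sum>i=1..t. \<Sum>j=1..k i. real (p i ^ j) * real (n choose (p i ^ j)))
    \<and> (real (n choose r) - (\<Sum>i=1..t. \<Sum>j=1..k i. real (p i ^ j) * real (n choose (p i ^ j)))) / real n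
      \<in> \<nat>"
proof -
  define S where "S = (\<Sum>i=1..t. \<Sum>j=1..k i. p i ^ j * (n choose (p i ^ j)))"
  have S: "(\<Sum>i=1..t. \<Sum>j=1..k i. real (p i ^ j) * real (n choose (p i ^ j))) = real S"
    by (simp add: S_def)
  have prime_p: "prime (p i)" and ndvd: "\<not> p i dvd r" if "i \<in> {1..t}" for i
    using that assms(2,6) by blast+
  have "n > 0"
    unfolding assms(4) using prime_p by (auto intro!: prod_pos simp: prime_gt_0_nat)
  \<comment> \<open>Every prime divides 0, so one index, here 1, suffices to exclude
    \<open>r = 0\<close>.\<close>
  have "r > 0"
    using ndvd[of 1] assms(1) by (cases r) auto
  \<comment> \<open>\<open>disjI1\<close> picks coprimality of the base \<open>p i\<close> over a
    zero exponent, so \<open>k i = 0\<close> needs no separate case.\<close>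
  have "coprime n r"
    unfolding assms(4)
    by (intro prod_coprime_left coprime_power_left_iff[THEN iffD2] disjI1 prime_imp_coprime
        prime_p ndvd)
  with \<open>r > 0\<close> have "n dvd (n choose r)"
    by (rule dvd_binomial_if_coprime[rotated])
  moreover have "n dvd S"
    unfolding S_def using prime_p
    by (intro dvd_sum dvd_mult_binomial) (simp add: prime_gt_0_nat)
  \<comment> \<open>This subtraction is truncated; only the bound on \<open>S\<close> below makes it
    agree with the real difference, whose quotient by \<open>n\<close> is then the natural number
    \<open>q\<close>.\<close>
  ultimately have "n dvd (n choose r) - S"
    by (rule dvd_diff_nat)
  then obtain q where "(n choose r) - S = n * q"
    by (elim dvdE)
  moreover have "S \<le> (n choose r)"
    using assms(7) by (simp add: S_def)
  ultimately have "real (n choose r) - real S = real n * real q"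
    by (metis of_nat_diff of_nat_mult)
  with \<open>n > 0\<close> show ?thesis
    unfolding S by (simp add: algebra_simps)
qed

end
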